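(* Let $r\neq\lambda$ be nonnegative integers and let $\mathcal{D}_1=(\mathcal{P},\mathcal{B}_1)$ and $\mathcal{D}_2=(\mathcal{P},\mathcal{B}_2)$ be two $(r,\lambda)$-designs on the same point set $\mathcal{P}$ of size $v$, each with $b$ blocks, where the blocks are listed as $\mathcal{B}_1=(B_{11},\dots,B_{1b})$ and $\mathcal{B}_2=(B_{21},\dots,B_{2b})$. Let $N_1,N_2$ be the corresponding $v\times b$ incidence matrices (columns in the listed order) and assume $N_1^TN_1=N_2^TN_2$. Define $$R=\frac{1}{r-\lambda}\left(N_1N_2^T-\lambda J_v\right).$$ Let $\Gamma$ be a finite simple graph whose vertex set contains $\mathcal{P}$, let $C$ be the induced subgraph of $\Gamma$ on $\mathcal{P}$ and $A_C$ its adjacency matrix (indexed by $\mathcal{P}$). Suppose that: (i) $R^TA_CR$ is an adjacency matrix (a symmetric $0/1$ matrix with zero diagonal); (ii) for every vertex $x\notin\mathcal{P}$ of $\Gamma$, the set of neighbours of $x$ in $\mathcal{P}$ equals $B_{1i}$ for some $i$. Construct a graph $\Gamma'$ on the same vertex set as follows: adjacencies between vertices outside $\mathcal{P}$ are unchanged; every vertex $x\notin\mathcal{P}$ whose neighbourhood in $\mathcal{P}$ is $B_{1i}$ is made adjacent (within $\mathcal{P}$) exactly to the points of $B_{2i}$; and the induced subgraph on $\mathcal{P}$ is replaced by the graph with adjacency matrix $R^TA_CR$. Then $\Gamma'$ is $\mathbb{R}$-cospectral with $\Gamma$.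
   Context: An $(r,\lambda)$-design is an incidence structure $(\mathcal{P},\mathcal{B})$, where $\mathcal{P}$ is a finite set of points and $\mathcal{B}$ is a finite multiset of subsets of $\mathcal{P}$ (blocks; repeated blocks and blocks of different sizes are allowed), such that every point lies in exactly $r$ blocks and every pair of distinct points lies in exactly $\lambda$ blocks. The incidence matrix $N$ has rows indexed by points and columns by blocks, with $N_{pB}=1$ if $p\in B$ and $0$ otherwise. $J_v$ is the $v\times v$ all-ones matrix. Two graphs with adjacency matrices $A,A'$ are $\mathbb{R}$-cospectral if $A+tJ$ and $A'+tJ$ have the same spectrum for every real $t$. *)

theory Defs
  imports "Jordan_Normal_Form.Spectral_Radius" "Graph_Theory.Pair_Digraph" "Graph_Theory.Digraph_Component" "HOL-Library.Multiset"
begin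

definition rl_design :: "nat \<Rightarrow> nat \<Rightarrow> 'a set \<Rightarrow> 'a set multiset \<Rightarrow> bool" where
  "rl_design r l P BB \<longleftrightarrow>
     finite P \<and>
     (\<forall>B \<in># BB. B \<subseteq> P) \<and>
     (\<forall>p\<in>P. size {#B \<in># BB. p \<in> B#} = r) \<and>
     (\<forall>p\<in>P. \<forall>q\<in>P. p \<noteq> q \<longrightarrow> size {#B \<in># BB. p \<in> B \<and> q \<in> B#} = l)"

text \<open>Matrices indexed by points or vertices are taken with respect to a list that enumerates the
  index set without repetition; the columns of an incidence matrix follow the given list of blocks.\<close>

definition incidence_matrix :: "'a list \<Rightarrow> 'a set list \<Rightarrow> real mat" where
  "incidence_matrix ps Bs =
     mat (length ps) (length Bs) (\<lambda>(i, j). if ps ! i \<in> Bs ! j then 1 else 0)"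

definition all_ones_matrix :: "nat \<Rightarrow> real mat" where
  "all_ones_matrix n = mat n n (\<lambda>_. 1)"

definition adjacency_matrix :: "'a list \<Rightarrow> 'a pair_pre_digraph \<Rightarrow> real mat" where
  "adjacency_matrix xs G =
     mat (length xs) (length xs) (\<lambda>(i, j). if (xs ! i, xs ! j) \<in> parcs G then 1 else 0)"

definition is_adjacency_matrix :: "real mat \<Rightarrow> bool" where
  "is_adjacency_matrix M \<longleftrightarrow>
     square_mat M \<and> transpose_mat M = M \<and>
     (\<forall>i < dim_row M. \<forall>j < dim_col M. M $$ (i, j) \<in> {0, 1}) \<and>
     (\<forall>i < dim_row M. M $$ (i, i) = 0)"

text \<open>The spectrum of a real matrix is the multiset of its complex eigenvalues, counted with
  algebraic multiplicity.\<close>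

definition spectrum_mset :: "real mat \<Rightarrow> complex multiset" where
  "spectrum_mset A = (let A' = map_mat complex_of_real A in
     \<Sum>k \<in> spectrum A'. replicate_mset (order k (char_poly A')) k)"

definition R_cospectral :: "real mat \<Rightarrow> real mat \<Rightarrow> bool" where
  "R_cospectral A A' \<longleftrightarrow>
     (\<forall>t. spectrum_mset (A + t \<cdot>\<^sub>m all_ones_matrix (dim_row A)) =
          spectrum_mset (A' + t \<cdot>\<^sub>m all_ones_matrix (dim_row A')))"

definition nbrs_in :: "'a set \<Rightarrow> 'a pair_pre_digraph \<Rightarrow> 'a \<Rightarrow> 'a set" where
  "nbrs_in P G x = {p \<in> P. (x, p) \<in> parcs G}"

text \<open>The new neighbours inside P of a vertex x outside P. If the old neighbourhood occurs
  several times in the first list, all the corresponding blocks of the second list coincide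
  in the situation of interest; see \<open>nbrs_in_switched_graph\<close> below.\<close>

definition switched_nbrs ::
  "'a list \<Rightarrow> 'a set list \<Rightarrow> 'a set list \<Rightarrow> 'a pair_pre_digraph \<Rightarrow> 'a \<Rightarrow> 'a set" where
  "switched_nbrs ps Bs1 Bs2 G x =
     {p \<in> set ps. \<exists>i < length Bs1. nbrs_in (set ps) G x = Bs1 ! i \<and> p \<in> Bs2 ! i}"

definition switched_graph ::
  "'a list \<Rightarrow> 'a set list \<Rightarrow> 'a set list \<Rightarrow> real mat \<Rightarrow> 'a pair_pre_digraph \<Rightarrow> 'a pair_pre_digraph" where
  "switched_graph ps Bs1 Bs2 M G =
     \<lparr> pverts = pverts G,
       parcs = {(x, y) \<in> parcs G. x \<notin> set ps \<and> y \<notin> set ps}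
         \<union> {(x, p). x \<in> pverts G - set ps \<and> p \<in> switched_nbrs ps Bs1 Bs2 G x}
         \<union> {(p, x). x \<in> pverts G - set ps \<and> p \<in> switched_nbrs ps Bs1 Bs2 G x}
         \<union> {(ps ! i, ps ! j) | i j. i < length ps \<and> j < length ps \<and> M $$ (i, j) = 1} \<rparr>"

lemma incidence_gram:
  assumes "distinct ps" "i < length Bs" "j < length Bs"
  shows "(transpose_mat (incidence_matrix ps Bs) * incidence_matrix ps Bs) $$ (i, j) =
         real (card (set ps \<inter> Bs ! i \<inter> Bs ! j))"
proof -
  have "(transpose_mat (incidence_matrix ps Bs) * incidence_matrix ps Bs) $$ (i, j) =
      (\<Sum>k<length ps. if ps ! k \<in> Bs ! i \<inter> Bs ! j then 1 else 0)"
    using assms by (auto simp: incidence_matrix_def scalar_prod_def atLeast0LessThan intro!: sum.cong)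
  also have "\<dots> = (\<Sum>p\<in>set ps. if p \<in> Bs ! i \<inter> Bs ! j then 1 else 0)"
    by (rule sum.reindex_bij_betw[OF bij_betw_nth]) (use assms in auto)
  also have "\<dots> = real (card (set ps \<inter> Bs ! i \<inter> Bs ! j))"
    by (subst sum.inter_filter[symmetric]) (auto intro!: arg_cong[of _ _ card])
  finally show ?thesis .
qed

lemma nbrs_in_switched_graph:
  assumes ps: "distinct ps"
    and len: "length Bs1 = length Bs2"
    and sub: "\<forall>B \<in> set Bs1 \<union> set Bs2. B \<subseteq> set ps"
    and gram: "transpose_mat (incidence_matrix ps Bs1) * incidence_matrix ps Bs1 =
               transpose_mat (incidence_matrix ps Bs2) * incidence_matrix ps Bs2"
    and x: "x \<in> pverts G - set ps"
    and i: "i < length Bs1" "nbrs_in (set ps) G x = Bs1 ! i"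
  shows "nbrs_in (set ps) (switched_graph ps Bs1 Bs2 M G) x = Bs2 ! i"
proof -
  have c: "card (Bs1 ! j \<inter> Bs1 ! k) = card (Bs2 ! j \<inter> Bs2 ! k)"
    if "j < length Bs1" "k < length Bs1" for j k
  proof -
    have "Bs1 ! j \<subseteq> set ps" "Bs2 ! j \<subseteq> set ps"
      using sub that len by auto
    then have "set ps \<inter> Bs1 ! j \<inter> Bs1 ! k = Bs1 ! j \<inter> Bs1 ! k"
         "set ps \<inter> Bs2 ! j \<inter> Bs2 ! k = Bs2 ! j \<inter> Bs2 ! k"
      by (simp_all add: Int_absorb1)
    moreover have "real (card (set ps \<inter> Bs1 ! j \<inter> Bs1 ! k)) = real (card (set ps \<inter> Bs2 ! j \<inter> Bs2 ! k))"
      unfolding incidence_gram[OF ps that, symmetric]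
        incidence_gram[OF ps that[unfolded len], symmetric] gram by (rule refl)
    ultimately show ?thesis by simp
  qed
  have same: "Bs2 ! j = Bs2 ! i" if j: "j < length Bs1" "Bs1 ! j = Bs1 ! i" for j
  proof -
    have "Bs2 ! j \<subseteq> set ps" "Bs2 ! i \<subseteq> set ps"
      using sub j i len by auto
    then have fin: "finite (Bs2 ! j)" "finite (Bs2 ! i)"
      by (auto intro: finite_subset)
    have eqs: "card (Bs2 ! j \<inter> Bs2 ! i) = card (Bs2 ! j)" "card (Bs2 ! j \<inter> Bs2 ! i) = card (Bs2 ! i)"
      using c[OF j(1) i(1)] c[OF j(1) j(1)] c[OF i(1) i(1)] j(2) by simp_all
    show ?thesis
      using card_subset_eq[OF fin(1) Int_lower1 eqs(1)] card_subset_eq[OF fin(2) Int_lower2 eqs(2)]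
      by (rule trans[OF sym])
  qed
  have "Bs2 ! i \<subseteq> set ps" using sub i len by auto
  then have "switched_nbrs ps Bs1 Bs2 G x = Bs2 ! i"
    unfolding switched_nbrs_def i(2) using i(1) same by (blast dest: sym)
  moreover have "nbrs_in (set ps) (switched_graph ps Bs1 Bs2 M G) x = switched_nbrs ps Bs1 Bs2 G x"
    using x by (auto simp: nbrs_in_def switched_graph_def switched_nbrs_def)
  ultimately show ?thesis by (rule trans[rotated])
qed

end

theory Submission
  imports Defs
begin

text \<open>Both designs satisfy \<open>N N\<^sup>T = (r - \<lambda>) I + \<lambda> J\<close>, and the common Gram matrix determines the
  column sums, so \<open>J N\<^sub>1 = J N\<^sub>2\<close>. Hence \<open>R\<^sup>T N\<^sub>1 = N\<^sub>2\<close>, \<open>R\<^sup>T R = I\<close> and \<open>R J = R\<^sup>T J = J\<close>. Extending \<open>R\<close>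
  by the identity outside the point set gives an orthogonal matrix \<open>Q\<close> such that \<open>Q\<^sup>T A Q\<close> is the
  adjacency matrix of the switched graph and \<open>Q\<^sup>T J Q = J\<close>; so \<open>A + t J\<close> and \<open>A' + t J\<close> are
  similar for every \<open>t\<close>.\<close>

section \<open>Spectra of similar matrices\<close>

text \<open>The multiset depends on the characteristic polynomial alone: the eigenvalues are its
  roots and the multiplicities their orders. Similarity over the reals preserves this polynomial,
  and embedding into the complex numbers commutes with taking it.\<close>

lemma spectrum_mset_similar:
  assumes "similar_mat A B"
  shows "spectrum_mset A = spectrum_mset B"
proof -
  obtain n where A: "A \<in> carrier_mat n n" and B: "B \<in> carrier_mat n n"
    using similar_matD[OF assms] by auto
  let ?A = "map_mat complex_of_real A" and ?B = "map_mat complex_of_real B"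
  have cp: "char_poly ?A = char_poly ?B"
    by (simp add: of_real_hom.char_poly_hom[OF A] of_real_hom.char_poly_hom[OF B]
        char_poly_similar[OF assms])
  have "spectrum ?A = spectrum ?B"
    unfolding spectrum_def using A B
    by (auto simp: eigenvalue_root_char_poly[of _ n] cp)
  then show ?thesis
    unfolding spectrum_mset_def Let_def cp by simp
qed

section \<open>Square matrices indexed by the elements of a list\<close>

text \<open>Entries are a function of elements rather than of indices, so that matrices over the
  point list and over the vertex list can share one entry function and products become sums over
  sets.\<close>

definition mat_on :: "'a list \<Rightarrow> ('a \<Rightarrow> 'a \<Rightarrow> real) \<Rightarrow> real mat" where
  "mat_on xs f = mat (length xs) (length xs) (\<lambda>(i, j). f (xs ! i) (xs ! j))"

lemma mat_on_carrier [simp]: "mat_on xs f \<in> carrier_mat (length xs) (length xs)"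
  by (simp add: mat_on_def)

lemma transpose_mat_on: "transpose_mat (mat_on xs f) = mat_on xs (\<lambda>x y. f y x)"
  by (rule eq_matI) (auto simp: mat_on_def)

lemma adjacency_matrix_mat_on:
  "adjacency_matrix xs G = mat_on xs (\<lambda>x y. of_bool ((x, y) \<in> parcs G))"
  by (rule eq_matI) (auto simp: mat_on_def adjacency_matrix_def)

lemma all_ones_mat_on: "all_ones_matrix (length xs) = mat_on xs (\<lambda>_ _. 1)"
  by (rule eq_matI) (auto simp: mat_on_def all_ones_matrix_def)

lemma one_mat_on:
  assumes "distinct xs"
  shows "1\<^sub>m (length xs) = mat_on xs (\<lambda>x y. of_bool (x = y))"
  by (rule eq_matI) (use assms in \<open>auto simp: mat_on_def nth_eq_iff_index_eq\<close>)

lemma sum_nth_distinct: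
  assumes "distinct xs"
  shows "(\<Sum>i<length xs. f (xs ! i)) = (\<Sum>x\<in>set xs. f x)"
  by (rule sum.reindex_bij_betw[OF bij_betw_nth]) (use assms in auto)

lemma mat_on_mult:
  assumes "distinct xs"
  shows "mat_on xs f * mat_on xs g = mat_on xs (\<lambda>x y. \<Sum>z\<in>set xs. f x z * g z y)"
  by (rule eq_matI)
    (auto simp: mat_on_def scalar_prod_def atLeast0LessThan sum_nth_distinct[OF assms, symmetric])

lemma mat_on_cong:
  assumes "\<And>x y. x \<in> set xs \<Longrightarrow> y \<in> set xs \<Longrightarrow> f x y = g x y"
  shows "mat_on xs f = mat_on xs g"
  by (rule eq_matI) (auto simp: mat_on_def assms)

lemma mat_on_eqD:
  assumes "mat_on xs f = mat_on xs g" "x \<in> set xs" "y \<in> set xs"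
  shows "f x y = g x y"
proof -
  obtain i j where ij: "i < length xs" "j < length xs" "x = xs ! i" "y = xs ! j"
    using assms by (auto simp: in_set_conv_nth)
  have "mat_on xs f $$ (i, j) = mat_on xs g $$ (i, j)"
    using assms(1) by simp
  then show ?thesis using ij by (simp add: mat_on_def)
qed

text \<open>Distinctness makes \<open>(!) xs\<close> injective, so every element has a unique index
  at which to read the entry. This brings in \<open>R\<close>, which is given only as a
  matrix.\<close>

lemma mat_on_exhaust:
  assumes "distinct xs" "M \<in> carrier_mat (length xs) (length xs)"
  obtains f where "M = mat_on xs f"
proof
  let ?idx = "the_inv_into {..<length xs} ((!) xs)"
  have "?idx (xs ! i) = i" if "i < length xs" for i
    using that assms(1) by (intro the_inv_into_f_f inj_on_nth) auto
  then show "M = mat_on xs (\<lambda>x y. M $$ (?idx x, ?idx y))"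
    using assms(2) by (intro eq_matI) (auto simp: mat_on_def)
qed

section \<open>Incidence matrices\<close>

lemma incidence_matrix_carrier [simp]:
  "incidence_matrix ps Bs \<in> carrier_mat (length ps) (length Bs)"
  by (simp add: incidence_matrix_def)

lemma all_ones_matrix_carrier [simp]: "all_ones_matrix n \<in> carrier_mat n n"
  by (simp add: all_ones_matrix_def)

text \<open>Entry (i, j) counts the blocks through both points, which is r on the diagonal and
  \<lambda> off it.\<close>

lemma incidence_mult_transpose:
  assumes design: "rl_design r l (set ps) (mset Bs)" and ps: "distinct ps"
  shows "incidence_matrix ps Bs * transpose_mat (incidence_matrix ps Bs) =
         (real r - real l) \<cdot>\<^sub>m 1\<^sub>m (length ps) + real l \<cdot>\<^sub>m all_ones_matrix (length ps)"
    (is "?L = ?R")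
proof (rule eq_matI)
  fix i j assume "i < dim_row ?R" "j < dim_col ?R"
  then have ij: "i < length ps" "j < length ps"
    by (simp_all add: all_ones_matrix_def)
  have "?L $$ (i, j) = (\<Sum>k<length Bs. if ps ! i \<in> Bs ! k \<and> ps ! j \<in> Bs ! k then 1 else 0)"
    using ij by (auto simp: incidence_matrix_def scalar_prod_def atLeast0LessThan intro!: sum.cong)
  also have "\<dots> = real (card {k. k < length Bs \<and> ps ! i \<in> Bs ! k \<and> ps ! j \<in> Bs ! k})"
    by (subst sum.inter_filter[symmetric]) (auto intro!: arg_cong[of _ _ card])
  \<comment> \<open>Counting positions in the list counts repeated blocks with multiplicity, as the
    multiset does.\<close>
  also have "\<dots> = real (size {#B \<in># mset Bs. ps ! i \<in> B \<and> ps ! j \<in> B#})"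
    by (simp add: length_filter_conv_card flip: mset_filter)
  also have "\<dots> = real (if i = j then r else l)"
    using design ij ps by (auto simp: rl_design_def nth_eq_iff_index_eq)
  also have "\<dots> = ?R $$ (i, j)"
    using ij by (auto simp: all_ones_matrix_def)
  finally show "?L $$ (i, j) = ?R $$ (i, j)" .
qed (simp_all add: all_ones_matrix_def incidence_matrix_def)

text \<open>The column sums of a 0/1 matrix are the diagonal entries of its Gram matrix.\<close>

lemma all_ones_mult_incidence:
  assumes gram: "transpose_mat (incidence_matrix ps Bs1) * incidence_matrix ps Bs1 =
                 transpose_mat (incidence_matrix ps Bs2) * incidence_matrix ps Bs2"
    and len: "length Bs1 = length Bs2"
  shows "all_ones_matrix (length ps) * incidence_matrix ps Bs1 =
         all_ones_matrix (length ps) * incidence_matrix ps Bs2"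
proof -
  have entry: "(all_ones_matrix (length ps) * incidence_matrix ps Bs) $$ (i, j) =
      (transpose_mat (incidence_matrix ps Bs) * incidence_matrix ps Bs) $$ (j, j)"
    if "i < length ps" "j < length Bs" for i j Bs
    using that
    by (auto simp: all_ones_matrix_def incidence_matrix_def scalar_prod_def intro!: sum.cong)
  show ?thesis
  proof (rule eq_matI)
    fix i j
    assume "i < dim_row (all_ones_matrix (length ps) * incidence_matrix ps Bs2)"
      and "j < dim_col (all_ones_matrix (length ps) * incidence_matrix ps Bs2)"
    then have "i < length ps" "j < length Bs1" "j < length Bs2"
      using len by (simp_all add: all_ones_matrix_def incidence_matrix_def)
    then show "(all_ones_matrix (length ps) * incidence_matrix ps Bs1) $$ (i, j) =
               (all_ones_matrix (length ps) * incidence_matrix ps Bs2) $$ (i, j)"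
      by (simp only: entry gram)
  qed (use len in \<open>simp_all add: incidence_matrix_def\<close>)
qed

lemma transpose_all_ones_matrix [simp]: "transpose_mat (all_ones_matrix n) = all_ones_matrix n"
  by (rule eq_matI) (auto simp: all_ones_matrix_def)

section \<open>The switching matrix\<close>

text \<open>This isolates the matrix identities from the designs; \<open>c\<close> stands for r -
  \<lambda>, nonzero since r and \<lambda> differ.\<close>

locale switching_pair =
  fixes N1 N2 :: "real mat" and v b :: nat and c l :: real
  assumes N1 [simp]: "N1 \<in> carrier_mat v b" and N2 [simp]: "N2 \<in> carrier_mat v b"
    and c: "c \<noteq> 0"
    and N2_N2T: "N2 * transpose_mat N2 = c \<cdot>\<^sub>m 1\<^sub>m v + l \<cdot>\<^sub>m all_ones_matrix v"
    and gram: "transpose_mat N1 * N1 = transpose_mat N2 * N2"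
    and ones: "all_ones_matrix v * N1 = all_ones_matrix v * N2"
begin

definition R where "R = (1 / c) \<cdot>\<^sub>m (N1 * transpose_mat N2 - l \<cdot>\<^sub>m all_ones_matrix v)"

abbreviation J where "J \<equiv> all_ones_matrix v"

lemma R_carrier [simp]: "R \<in> carrier_mat v v"
  using N1 N2 all_ones_matrix_carrier[of v] unfolding R_def by (intro smult_carrier_mat minus_carrier_mat) auto

lemma NT [simp]: "transpose_mat N1 \<in> carrier_mat b v" "transpose_mat N2 \<in> carrier_mat b v"
  using N1 N2 by simp_all

lemma transpose_R: "transpose_mat R = (1 / c) \<cdot>\<^sub>m (N2 * transpose_mat N1 - l \<cdot>\<^sub>m J)"
proof -
  have "transpose_mat (N1 * transpose_mat N2 - l \<cdot>\<^sub>m J) =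
      transpose_mat (N1 * transpose_mat N2) - transpose_mat (l \<cdot>\<^sub>m J)"
    by (rule transpose_minus[of _ v v])
      (use N1 N2 all_ones_matrix_carrier[of v] in \<open>auto intro: mult_carrier_mat[of _ v b]\<close>)
  moreover have "transpose_mat (N1 * transpose_mat N2) = N2 * transpose_mat N1"
    by (subst transpose_mult[OF N1 NT(2)]) simp
  moreover have "transpose_mat (l \<cdot>\<^sub>m J) = l \<cdot>\<^sub>m J"
    by (rule eq_matI) (auto simp: all_ones_matrix_def)
  moreover have "transpose_mat (k \<cdot>\<^sub>m M) = k \<cdot>\<^sub>m transpose_mat M" for k :: real and M
    by (rule eq_matI) auto
  ultimately show ?thesis by (simp add: R_def)
qed

lemma N2_N2T_minus: "N2 * transpose_mat N2 - l \<cdot>\<^sub>m J = c \<cdot>\<^sub>m 1\<^sub>m v"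
  unfolding N2_N2T by (rule eq_matI) (auto simp: all_ones_matrix_def)

text \<open>Reassociating makes the result depend on \<open>X\<close> and \<open>Y\<close> only
  through \<open>X * Y\<close> and \<open>J * Y\<close>. It is applied with both transposed
  incidence matrices as \<open>X\<close>.\<close>

lemma scaled_mult:
  assumes X [simp]: "X \<in> carrier_mat b v" and Y: "Y \<in> carrier_mat v n"
  shows "((1 / c) \<cdot>\<^sub>m (N2 * X - l \<cdot>\<^sub>m J)) * Y = (1 / c) \<cdot>\<^sub>m (N2 * (X * Y) - l \<cdot>\<^sub>m (J * Y))"
proof -
  have [simp]: "N2 * X \<in> carrier_mat v v" by (rule mult_carrier_mat[OF N2 X])
  have [simp]: "l \<cdot>\<^sub>m J \<in> carrier_mat v v" by simp
  have "N2 * X - l \<cdot>\<^sub>m J \<in> carrier_mat v v"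
    by (rule minus_carrier_mat) simp
  then show ?thesis
    using Y by (simp add: mult_smult_assoc_mat[of _ v v _ n] minus_mult_distrib_mat[of _ v v _ _ n]
        assoc_mult_mat[of _ v b _ v _ n])
qed

text \<open>By the hypotheses, \<open>Y1\<close> together with N1^T may be traded for
  \<open>Y2\<close> together with N2^T. The remaining factor (N2 N2^T - l J) / c is the identity.
  Both R^T N1 = N2 and R^T J = J are instances.\<close>

lemma transpose_R_mult:
  assumes Y: "Y1 \<in> carrier_mat v n" "Y2 \<in> carrier_mat v n"
    and "transpose_mat N1 * Y1 = transpose_mat N2 * Y2" and "J * Y1 = J * Y2"
  shows "transpose_mat R * Y1 = Y2"
proof -
  have "transpose_mat R * Y1 = ((1 / c) \<cdot>\<^sub>m (N2 * transpose_mat N2 - l \<cdot>\<^sub>m J)) * Y2"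
    unfolding transpose_R scaled_mult[OF NT(1) Y(1)] scaled_mult[OF NT(2) Y(2)] assms(3,4) ..
  also have "(1 / c) \<cdot>\<^sub>m (N2 * transpose_mat N2 - l \<cdot>\<^sub>m J) = 1\<^sub>m v"
    unfolding N2_N2T_minus by (rule eq_matI) (use c in auto)
  finally show ?thesis using Y(2) by simp
qed

lemma transpose_R_N1: "transpose_mat R * N1 = N2"
  by (rule transpose_R_mult[OF N1 N2 gram ones])

lemma transpose_R_J: "transpose_mat R * J = J"
proof (rule transpose_R_mult[where n = v])
  \<comment> \<open>Equal column sums, transposed, since J is symmetric.\<close>
  have "transpose_mat (J * N1) = transpose_mat (J * N2)"
    by (simp only: ones)
  then show "transpose_mat N1 * J = transpose_mat N2 * J"
    using N1 N2 by (simp add: transpose_mult[of _ v v _ b])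
qed auto

text \<open>Only the right factor is expanded, so that R^T meets N1 and J, on which its action is
  already known.\<close>

lemma transpose_R_R: "transpose_mat R * R = 1\<^sub>m v"
proof -
  have T: "transpose_mat R \<in> carrier_mat v v" by simp
  have P: "N1 * transpose_mat N2 \<in> carrier_mat v v" by (rule mult_carrier_mat[OF N1 NT(2)])
  have "transpose_mat R * R = (1 / c) \<cdot>\<^sub>m (transpose_mat R * (N1 * transpose_mat N2) - l \<cdot>\<^sub>m (transpose_mat R * J))"
    using T P
    by (subst (2) R_def) (simp add: mult_smult_distrib[of _ v v _ v] mult_minus_distrib_mat[of _ v v _ v] minus_carrier_mat)
  also have "transpose_mat R * (N1 * transpose_mat N2) = N2 * transpose_mat N2"
    using assoc_mult_mat[OF T N1 NT(2)] by (simp add: transpose_R_N1)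
  also have "(1 / c) \<cdot>\<^sub>m (N2 * transpose_mat N2 - l \<cdot>\<^sub>m (transpose_mat R * J)) = 1\<^sub>m v"
    unfolding transpose_R_J N2_N2T_minus by (rule eq_matI) (use c in auto)
  finally show ?thesis .
qed

text \<open>A one-sided inverse of a square matrix is two-sided, so R undoes R^T, and R^T fixes
  J.\<close>

lemma R_J: "R * J = J"
proof -
  have T: "transpose_mat R \<in> carrier_mat v v" by simp
  have "R * J = R * (transpose_mat R * J)" by (simp only: transpose_R_J)
  also have "\<dots> = (R * transpose_mat R) * J"
    by (rule assoc_mult_mat[OF R_carrier T all_ones_matrix_carrier, symmetric])
  also have "R * transpose_mat R = 1\<^sub>m v"
    by (rule mat_mult_left_right_inverse[OF T R_carrier transpose_R_R])
  finally show ?thesis by (simp add: left_mult_one_mat[of _ v v])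
qed

end

section \<open>Extending a matrix by the identity\<close>

text \<open>The block diagonal matrix with blocks \<rho> and I, written so that the points may
  occupy any positions in the vertex list.\<close>

definition extend_id :: "'a set \<Rightarrow> ('a \<Rightarrow> 'a \<Rightarrow> real) \<Rightarrow> 'a \<Rightarrow> 'a \<Rightarrow> real" where
  "extend_id P \<rho> x y = (if x \<in> P \<and> y \<in> P then \<rho> x y else of_bool (x = y))"

text \<open>A column indexed by a point is supported on P; any other column is a unit
  vector.\<close>

lemma sum_extend_id:
  assumes "finite V" "P \<subseteq> V" "x \<in> V"
  shows "(\<Sum>z\<in>V. extend_id P \<rho> z x * f z) = (if x \<in> P then \<Sum>z\<in>P. \<rho> z x * f z else f x)"
proof (cases "x \<in> P")
  case True
  then have "(\<Sum>z\<in>V. extend_id P \<rho> z x * f z) = (\<Sum>z\<in>P. extend_id P \<rho> z x * f z)"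
    using assms by (intro sum.mono_neutral_right) (auto simp: extend_id_def)
  then show ?thesis using True by (simp add: extend_id_def)
next
  case False
  then have "(\<Sum>z\<in>V. extend_id P \<rho> z x * f z) = (\<Sum>z\<in>V. if z = x then f z else 0)"
    by (intro sum.cong) (auto simp: extend_id_def)
  then show ?thesis using False assms by simp
qed

text \<open>The four cases are the blocks of the conjugate by a block diagonal matrix: both factors
  act on the P-by-P block, one factor on each mixed block, and none outside.\<close>

lemma transpose_conj_mat_on:
  fixes \<rho> :: "'a \<Rightarrow> 'a \<Rightarrow> real"
  assumes vs: "distinct vs" and P: "P \<subseteq> set vs"
  defines "Q \<equiv> mat_on vs (extend_id P \<rho>)"
  shows "transpose_mat Q * mat_on vs f * Q = mat_on vs (\<lambda>x y.
    if x \<in> P then if y \<in> P then \<Sum>z\<in>P. \<Sum>w\<in>P. \<rho> z x * f z w * \<rho> w y else \<Sum>z\<in>P. \<rho> z x * f z y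
    else if y \<in> P then \<Sum>w\<in>P. f x w * \<rho> w y else f x y)"
    (is "_ = mat_on vs ?g")
proof -
  have "transpose_mat Q * mat_on vs f * Q = transpose_mat Q * (mat_on vs f * Q)"
    unfolding Q_def by (rule assoc_mult_mat[of _ "length vs" "length vs" _ "length vs" _ "length vs"]) auto
  \<comment> \<open>Both sums are arranged with the extended factor first, the shape that
    \<open>sum_extend_id\<close> collapses.\<close>
  also have "\<dots> = mat_on vs (\<lambda>x y. \<Sum>z\<in>set vs. extend_id P \<rho> z x * (\<Sum>w\<in>set vs. extend_id P \<rho> w y * f z w))"
    unfolding Q_def transpose_mat_on mat_on_mult[OF vs] by (simp add: mult.commute)
  also have "\<dots> = mat_on vs ?g"
  proof (rule mat_on_cong, goal_cases)
    case (1 x y)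
    show ?case
      unfolding sum_extend_id[OF finite_set P 1(1)] sum_extend_id[OF finite_set P 1(2)]
      by (auto simp: sum_distrib_left mult_ac)
  qed
  finally show ?thesis .
qed

text \<open>Conjugation by Q is linear and fixes J, so one orthogonal Q serves every t.\<close>

lemma similar_plus_all_ones:
  assumes [simp]: "A \<in> carrier_mat n n" "A' \<in> carrier_mat n n" "Q \<in> carrier_mat n n"
    and QQ: "transpose_mat Q * Q = 1\<^sub>m n"
    and A: "transpose_mat Q * A * Q = A'"
    and J: "transpose_mat Q * all_ones_matrix n * Q = all_ones_matrix n"
  shows "similar_mat (A' + t \<cdot>\<^sub>m all_ones_matrix n) (A + t \<cdot>\<^sub>m all_ones_matrix n)"
proof (rule similar_matI[of _ _ "transpose_mat Q" Q n])
  have T: "transpose_mat Q \<in> carrier_mat n n" by simp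
  show "Q * transpose_mat Q = 1\<^sub>m n"
    by (rule mat_mult_left_right_inverse[OF T _ QQ]) simp
  have [simp]: "transpose_mat Q * all_ones_matrix n \<in> carrier_mat n n" "transpose_mat Q * A \<in> carrier_mat n n"
    by (auto intro!: mult_carrier_mat[of _ n n])
  have "transpose_mat Q * (A + t \<cdot>\<^sub>m all_ones_matrix n) * Q =
      transpose_mat Q * A * Q + t \<cdot>\<^sub>m (transpose_mat Q * all_ones_matrix n * Q)"
    by (simp add: mult_add_distrib_mat[of _ n n _ n] add_mult_distrib_mat[of _ n n _ _ n]
        mult_smult_distrib[of _ n n _ n] mult_smult_assoc_mat[of _ n n _ n])
  then show "A' + t \<cdot>\<^sub>m all_ones_matrix n = transpose_mat Q * (A + t \<cdot>\<^sub>m all_ones_matrix n) * Q"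
    by (simp only: A J)
qed (use QQ in auto)

section \<open>The switched graph\<close>

lemma parcs_switched_graph:
  assumes "distinct ps"
  shows "parcs (switched_graph ps Bs1 Bs2 (mat_on ps \<mu>) G) =
    {(x, y) \<in> parcs G. x \<notin> set ps \<and> y \<notin> set ps}
    \<union> {(x, p). x \<in> pverts G - set ps \<and> p \<in> switched_nbrs ps Bs1 Bs2 G x}
    \<union> {(p, x). x \<in> pverts G - set ps \<and> p \<in> switched_nbrs ps Bs1 Bs2 G x}
    \<union> {(p, q). p \<in> set ps \<and> q \<in> set ps \<and> \<mu> p q = 1}"
proof -
  have "{(ps ! i, ps ! j) | i j. i < length ps \<and> j < length ps \<and> mat_on ps \<mu> $$ (i, j) = 1} =
      {(p, q). p \<in> set ps \<and> q \<in> set ps \<and> \<mu> p q = 1}"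
    by (force simp: mat_on_def in_set_conv_nth)
  then show ?thesis by (simp add: switched_graph_def)
qed

lemma is_adjacency_matrix_mat_onD:
  assumes "is_adjacency_matrix (mat_on ps \<mu>)" "p \<in> set ps" "q \<in> set ps"
  shows "\<mu> p q \<in> {0, 1}" "\<mu> q p = \<mu> p q" "\<mu> p p = 0"
proof -
  obtain i j where ij: "i < length ps" "j < length ps" "p = ps ! i" "q = ps ! j"
    using assms(2,3) by (auto simp: in_set_conv_nth)
  have "mat_on ps \<mu> $$ (i, j) \<in> {0, 1}" "mat_on ps \<mu> $$ (i, i) = 0"
    using assms(1) ij(1,2) by (simp_all add: is_adjacency_matrix_def mat_on_def)
  then show "\<mu> p q \<in> {0, 1}" "\<mu> p p = 0"
    using ij by (simp_all add: mat_on_def)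
  have "mat_on ps (\<lambda>x y. \<mu> y x) = mat_on ps \<mu>"
    using assms(1) by (metis is_adjacency_matrix_def transpose_mat_on)
  then show "\<mu> q p = \<mu> p q"
    using assms(2,3) by (rule mat_on_eqD)
qed

text \<open>Outside the points, symmetry and absence of loops are inherited from \<open>G\<close>;
  inside, they come from the adjacency matrix. Mixed arcs are inserted in both directions and have
  exactly one end among the points.\<close>

lemma pair_graph_switched_graph:
  assumes G: "pair_graph G" and ps: "distinct ps" "set ps \<subseteq> pverts G"
    and M: "is_adjacency_matrix (mat_on ps \<mu>)"
  shows "pair_graph (switched_graph ps Bs1 Bs2 (mat_on ps \<mu>) G)" (is "pair_graph ?G'")
proof -
  interpret pair_graph G by (rule G)
  have V: "pverts ?G' = pverts G" by (simp add: switched_graph_def)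
  have nb: "switched_nbrs ps Bs1 Bs2 G x \<subseteq> set ps" for x
    by (auto simp: switched_nbrs_def)
  have sub: "parcs ?G' \<subseteq> pverts G \<times> pverts G"
    unfolding parcs_switched_graph[OF ps(1)] using ps(2) nb by (auto dest: in_arcsD1 in_arcsD2)
  have sym: "sym (parcs ?G')"
    unfolding parcs_switched_graph[OF ps(1)]
    by (rule symI) (auto simp: is_adjacency_matrix_mat_onD(2)[OF M] intro: arcs_symmetric)
  have loop: "fst e \<noteq> snd e" if "e \<in> parcs ?G'" for e
    using that nb unfolding parcs_switched_graph[OF ps(1)]
    by (fastforce simp: is_adjacency_matrix_mat_onD(3)[OF M] dest: pair_no_loops)
  show ?thesis
  proof unfold_locales
    show "finite (parcs ?G')"
      by (rule finite_subset[OF sub]) (simp add: pair_finite_verts)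
    show "symmetric (with_proj ?G')"
      using sym by (simp add: symmetric_def)
  qed (use sub loop V pair_finite_verts in auto)
qed

theorem mainTheorem1:
  fixes r l v b :: nat
    and P :: "'a set"
    and ps vs :: "'a list"
    and Bs1 Bs2 :: "'a set list"
    and \<Gamma> \<Gamma>' C :: "'a pair_pre_digraph"
    and N1 N2 R :: "real mat"
  assumes "r \<noteq> l"
    and "card P = v" and "length Bs1 = b" and "length Bs2 = b"
    and "rl_design r l P (mset Bs1)"
    and "rl_design r l P (mset Bs2)"
    and "distinct ps" and "set ps = P"
    and N1: "N1 = incidence_matrix ps Bs1"
    and N2: "N2 = incidence_matrix ps Bs2"
    and "transpose_mat N1 * N1 = transpose_mat N2 * N2"
    and R: "R = (1 / (real r - real l)) \<cdot>\<^sub>m (N1 * transpose_mat N2 - real l \<cdot>\<^sub>m all_ones_matrix v)"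
    and "pair_graph \<Gamma>" and "P \<subseteq> pverts \<Gamma>"
    and "distinct vs" and "set vs = pverts \<Gamma>"
    and "induced_subgraph (with_proj C) (with_proj \<Gamma>)" and "pverts C = P"
    and "is_adjacency_matrix (transpose_mat R * adjacency_matrix ps C * R)"
    and "\<forall>x \<in> pverts \<Gamma> - P. \<exists>i < b. nbrs_in P \<Gamma> x = Bs1 ! i"
    and \<Gamma>': "\<Gamma>' = switched_graph ps Bs1 Bs2 (transpose_mat R * adjacency_matrix ps C * R) \<Gamma>"
  shows "pair_graph \<Gamma>' \<and> R_cospectral (adjacency_matrix vs \<Gamma>) (adjacency_matrix vs \<Gamma>')"
proof -
  note ps = \<open>distinct ps\<close> and P = \<open>set ps = P\<close> and vs = \<open>distinct vs\<close> \<open>set vs = pverts \<Gamma>\<close>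
  have v: "v = length ps"
    using assms(2) distinct_card[OF ps] by (simp add: P)
  have PV: "P \<subseteq> set vs" using assms(14) vs by simp
  interpret G: pair_graph \<Gamma> by fact
  interpret S: switching_pair N1 N2 v b "real r - real l" "real l"
  proof
    show "N1 \<in> carrier_mat v b" "N2 \<in> carrier_mat v b"
      unfolding N1 N2 v using incidence_matrix_carrier[of ps Bs1] incidence_matrix_carrier[of ps Bs2]
      by (simp_all only: assms(3,4))
    show "N2 * transpose_mat N2 = (real r - real l) \<cdot>\<^sub>m 1\<^sub>m v + real l \<cdot>\<^sub>m all_ones_matrix v"
      unfolding N2 v by (rule incidence_mult_transpose[OF assms(6)[folded P] ps])
    show "all_ones_matrix v * N1 = all_ones_matrix v * N2"
      unfolding N1 N2 v
      by (rule all_ones_mult_incidence[OF assms(11)[unfolded N1 N2]]) (simp add: assms(3,4))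
    show "real r - real l \<noteq> 0" using assms(1) by simp
    show "transpose_mat N1 * N1 = transpose_mat N2 * N2" by fact
  qed
  have SR: "S.R = R" by (simp add: R S.R_def)
  have "R \<in> carrier_mat (length ps) (length ps)" using S.R_carrier SR v by simp
  then obtain \<rho> where \<rho>: "R = mat_on ps \<rho>"
    using ps by (elim mat_on_exhaust[rotated])
  note on = transpose_mat_on all_ones_mat_on one_mat_on[OF ps] mat_on_mult[OF ps] P
  \<comment> \<open>Entrywise forms of R^T R = I, R J = J and R^T J = J: orthonormal columns, and
    row and column sums equal to 1.\<close>
  have \<rho>_orth: "(\<Sum>z\<in>P. \<rho> z p * \<rho> z q) = of_bool (p = q)" if "p \<in> P" "q \<in> P" for p q
    using mat_on_eqD[OF S.transpose_R_R[unfolded SR, unfolded v \<rho> on], of p q] that P by simp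
  have \<rho>_rows: "(\<Sum>z\<in>P. \<rho> p z) = 1" if "p \<in> P" for p
    using mat_on_eqD[OF S.R_J[unfolded SR, unfolded v \<rho> on], of p p] that P by simp
  have \<rho>_cols: "(\<Sum>z\<in>P. \<rho> z p) = 1" if "p \<in> P" for p
    using mat_on_eqD[OF S.transpose_R_J[unfolded SR, unfolded v \<rho> on], of p p] that P by simp
  \<comment> \<open>R^T N1 = N2 read entrywise: R^T sends the indicator vector of each first block
    to that of its partner. Incidence matrices are rectangular and outside the scope of
    \<open>mat_on\<close>, so this goes through explicit indices.\<close>
  have \<rho>_block: "(\<Sum>z\<in>P. \<rho> z p * of_bool (z \<in> Bs1 ! i)) = of_bool (p \<in> Bs2 ! i)"
    if "p \<in> P" "i < b" for p i
  proof -
    obtain k where k: "k < length ps" "p = ps ! k"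
      using \<open>p \<in> P\<close> P by (auto simp: in_set_conv_nth)
    have "(\<Sum>z\<in>P. \<rho> z p * of_bool (z \<in> Bs1 ! i)) =
        (\<Sum>j<length ps. \<rho> (ps ! j) p * of_bool (ps ! j \<in> Bs1 ! i))"
      unfolding P[symmetric] by (rule sum_nth_distinct[OF ps, symmetric])
    also have "\<dots> = (transpose_mat R * N1) $$ (k, i)"
      unfolding \<rho> N1 using k that(2) assms(3)
      by (simp add: mat_on_def incidence_matrix_def scalar_prod_def atLeast0LessThan of_bool_def
          cong: sum.cong_simp)
    also have "\<dots> = of_bool (p \<in> Bs2 ! i)"
      unfolding S.transpose_R_N1[unfolded SR] N2
      using k that assms(4) by (simp add: incidence_matrix_def)
    finally show ?thesis .
  qed

  define a where "a x y = (of_bool ((x, y) \<in> parcs \<Gamma>) :: real)" for x y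
  have a_sym: "a x y = a y x" for x y
    unfolding a_def by (rule arg_cong[of _ _ of_bool]) (blast intro: G.arcs_symmetric)
  define \<mu> where "\<mu> p q = (\<Sum>z\<in>P. \<Sum>w\<in>P. \<rho> z p * a z w * \<rho> w q)" for p q
  have "parcs C = {e \<in> parcs \<Gamma>. fst e \<in> P \<and> snd e \<in> P}"
    using assms(17,18) by (simp add: induced_subgraph_def)
  then have A_C: "adjacency_matrix ps C = mat_on ps a"
    unfolding adjacency_matrix_mat_on by (intro mat_on_cong) (simp add: a_def P)
  have M: "transpose_mat R * adjacency_matrix ps C * R = mat_on ps \<mu>"
    unfolding A_C \<rho> transpose_mat_on mat_on_mult[OF ps] P
    unfolding \<mu>_def sum_distrib_right by (rule mat_on_cong) (rule sum.swap)
  have adj: "is_adjacency_matrix (mat_on ps \<mu>)"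
    using assms(19) M by simp
  have graph: "pair_graph \<Gamma>'"
    unfolding \<Gamma>' M
    by (rule pair_graph_switched_graph[OF assms(13) ps _ adj]) (simp add: P assms(14))
  interpret G': pair_graph \<Gamma>' by (rule graph)

  define a' where "a' x y = (of_bool ((x, y) \<in> parcs \<Gamma>') :: real)" for x y
  have a'_sym: "a' x y = a' y x" for x y
    unfolding a'_def by (rule arg_cong[of _ _ of_bool]) (blast intro: G'.arcs_symmetric)
  have arcs: "parcs \<Gamma>' = {(x, y) \<in> parcs \<Gamma>. x \<notin> P \<and> y \<notin> P}
    \<union> {(x, p). x \<in> pverts \<Gamma> - P \<and> p \<in> switched_nbrs ps Bs1 Bs2 \<Gamma> x}
    \<union> {(p, x). x \<in> pverts \<Gamma> - P \<and> p \<in> switched_nbrs ps Bs1 Bs2 \<Gamma> x}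
    \<union> {(p, q). p \<in> P \<and> q \<in> P \<and> \<mu> p q = 1}"
    unfolding \<Gamma>' M parcs_switched_graph[OF ps] P ..
  have nbP: "switched_nbrs ps Bs1 Bs2 \<Gamma> x \<subseteq> P" for x
    using P by (auto simp: switched_nbrs_def)
  have a'_out: "a' x y = a x y" if "x \<notin> P" "y \<notin> P" for x y
    using that nbP by (auto simp: a'_def a_def arcs)
  \<comment> \<open>Arcs are placed where \<mu> equals 1; since \<mu> takes only the values 0 and 1
    here, they recover \<mu> exactly.\<close>
  have a'_in: "a' p q = \<mu> p q" if "p \<in> P" "q \<in> P" for p q
    using that is_adjacency_matrix_mat_onD(1)[OF adj, of p q] P by (auto simp: a'_def arcs)
  \<comment> \<open>The old row of \<open>x\<close> is the indicator of a first block and the new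
    row that of its partner, so \<open>\<rho>_block\<close> relates them.\<close>
  have a'_cross: "a' x p = (\<Sum>z\<in>P. a x z * \<rho> z p)" if "x \<in> set vs - P" "p \<in> P" for x p
  proof -
    from that(1) have "x \<in> pverts \<Gamma> - P" by (simp add: vs(2))
    then obtain i where i: "i < b" "nbrs_in P \<Gamma> x = Bs1 ! i"
      using bspec[OF assms(20)] by metis
    \<comment> \<open>Any such \<open>i\<close> will do: equal Gram matrices force the second list
      to repeat a block wherever the first one does.\<close>
    have nb: "nbrs_in P \<Gamma>' x = Bs2 ! i"
      unfolding \<Gamma>' P[symmetric]
    proof (rule nbrs_in_switched_graph[OF ps _ _ assms(11)[unfolded N1 N2]])
      show "\<forall>B\<in>set Bs1 \<union> set Bs2. B \<subseteq> set ps"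
        using assms(5,6) P by (auto simp: rl_design_def)
      show "length Bs1 = length Bs2" "i < length Bs1"
        using assms(3,4) i(1) by simp_all
      show "x \<in> pverts \<Gamma> - set ps" "nbrs_in (set ps) \<Gamma> x = Bs1 ! i"
        using that(1) vs(2) i(2) unfolding P by simp_all
    qed
    have "a' x p = of_bool (p \<in> Bs2 ! i)"
      unfolding a'_def nb[symmetric] nbrs_in_def using that(2) by simp
    also have "\<dots> = (\<Sum>z\<in>P. \<rho> z p * of_bool (z \<in> Bs1 ! i))"
      using \<rho>_block i that by simp
    also have "\<dots> = (\<Sum>z\<in>P. a x z * \<rho> z p)"
      unfolding a_def i(2)[symmetric] nbrs_in_def by (rule sum.cong) auto
    finally show ?thesis .
  qed

  define Q where "Q = mat_on vs (extend_id P \<rho>)"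
  note conj = transpose_conj_mat_on[OF vs(1) PV, of \<rho>, folded Q_def]
  have QA: "transpose_mat Q * adjacency_matrix vs \<Gamma> * Q = adjacency_matrix vs \<Gamma>'"
    unfolding adjacency_matrix_mat_on a_def[symmetric] a'_def[symmetric] conj
  proof (rule mat_on_cong, goal_cases)
    case (1 x y)
    \<comment> \<open>The other mixed block follows from \<open>a'_cross\<close> by symmetry of both
      graphs.\<close>
    have "a' x y = (\<Sum>z\<in>P. \<rho> z x * a z y)" if "x \<in> P" "y \<notin> P"
      using a'_cross[of y x] that 1 a'_sym[of x y] a_sym by (simp add: mult.commute)
    then show ?case
      using 1 by (auto simp: a'_in a'_out a'_cross \<mu>_def)
  qed
  \<comment> \<open>Each entry is a product of two column sums of Q, and all of these are 1.\<close>
  have QJ: "transpose_mat Q * all_ones_matrix (length vs) * Q = all_ones_matrix (length vs)"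
    unfolding all_ones_mat_on conj
    by (rule mat_on_cong) (auto simp: \<rho>_rows \<rho>_cols simp flip: sum_distrib_left)
  have QQ: "transpose_mat Q * Q = 1\<^sub>m (length vs)"
    unfolding Q_def transpose_mat_on mat_on_mult[OF vs(1)] one_mat_on[OF vs(1)]
  proof (rule mat_on_cong, goal_cases)
    case (1 x y)
    show ?case
      unfolding sum_extend_id[OF finite_set PV 1(1)]
      \<comment> \<open>A column inside P and one outside have disjoint supports; two inside are
        handled by \<open>\<rho>_orth\<close>.\<close>
      by (cases "y \<in> P") (auto simp: extend_id_def \<rho>_orth intro!: sum.neutral)
  qed
  have "similar_mat (adjacency_matrix vs \<Gamma>' + t \<cdot>\<^sub>m all_ones_matrix (length vs))
                    (adjacency_matrix vs \<Gamma> + t \<cdot>\<^sub>m all_ones_matrix (length vs))" for t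
    by (rule similar_plus_all_ones[OF _ _ _ QQ QA QJ]) (auto simp: Q_def adjacency_matrix_def)
  from spectrum_mset_similar[OF this]
  have "R_cospectral (adjacency_matrix vs \<Gamma>) (adjacency_matrix vs \<Gamma>')"
    by (simp add: R_cospectral_def adjacency_matrix_def)
  with graph show ?thesis by simp
qed

end
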